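(* Let $G$ be a finite group of order $60$. Then $\Omega_{\rho}(A_5)\leq\Omega_{\rho}(G)$, and $\Omega_{\rho}(G)=59$ if and only if $G\cong A_5$.
   Context: For a finite group $G$, let $o(x)$ denote the order of $x\in G$ and set $\rho(G)=\prod_{x\in G} o(x)$. For a positive integer $m=p_1^{\alpha_1}\cdots p_k^{\alpha_k}$ with $p_1,\dots,p_k$ distinct primes, $\Omega(m)=\alpha_1+\cdots+\alpha_k$ is the number of prime factors of $m$ counted with multiplicity (so $\Omega(1)=0$). Define $\Omega_{\rho}(G)=\Omega(\rho(G))$. $A_5$ denotes the alternating group of degree $5$. *)

theory Defs
  imports "HOL-Algebra.Algebra" "HOL-Computational_Algebra.Primes"
begin

definition rho :: "('a, 'b) monoid_scheme \<Rightarrow> nat" where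
  "rho G = (\<Prod>x\<in>carrier G. group.ord G x)"

definition bigOmega :: "nat \<Rightarrow> nat" where
  "bigOmega m = (\<Sum>p\<in>prime_factors m. multiplicity p m)"

definition Omega_rho :: "('a, 'b) monoid_scheme \<Rightarrow> nat" where
  "Omega_rho G = bigOmega (rho G)"

end

theory Submission
  imports Defs
begin

text \<open>
  Since \<open>bigOmega\<close> is additive on products, \<open>Omega_rho G\<close> is the sum of \<open>bigOmega (ord x)\<close> over the nontrivial
  elements \<open>x\<close>. Every summand is at least \<open>1\<close>, and it is \<open>1\<close> exactly for prime \<open>ord x\<close>. So a group of
  order \<open>60\<close> has \<open>Omega_rho G \<ge> 59\<close>, with equality if and only if all nontrivial elements have prime order
  (\<open>Omega_rho_eq_order_minus_1_iff\<close>). The alternating group of degree \<open>5\<close> has this property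
  (\<open>prime_ord_alt_group_5\<close>), and what remains is that it is the only such group of order \<open>60\<close>
  (\<open>iso_A5\<close>).

  Let all nontrivial elements of \<open>G\<close> have prime order. Elements of different prime orders never commute, so
  the centralizer of an element of order \<open>p\<close> is a \<open>p\<close>-group, and its class has a size divisible by the part
  of \<open>order G\<close> that is prime to \<open>p\<close> (\<open>conj_class_dvd\<close>). For order \<open>60\<close>, the numbers of elements of order \<open>2\<close>, \<open>3\<close>, \<open>5\<close>
  are thus positive multiples of \<open>15\<close>, \<open>20\<close>, \<open>12\<close> with sum \<open>59\<close>, which forces \<open>15\<close>, \<open>20\<close>, \<open>24\<close>
  (\<open>card_elems_of_ord\<close>).
  The \<open>15\<close> involutions form one class, with centralizers of order \<open>4\<close>. These are abelian, so commuting
  is an equivalence relation on the involutions, with five blocks of size \<open>3\<close>. Conjugation permutes the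
  blocks transitively; the kernel is contained in a block stabilizer of order \<open>12\<close>, while every nontrivial
  normal subgroup has at least \<open>13\<close> elements because every nontrivial class has at least \<open>12\<close>. This embeds
  \<open>G\<close> in the symmetric group of degree \<open>5\<close> (\<open>embeds_in_S5\<close>). The image is even because the \<open>44\<close> elements of order \<open>3\<close> and
  \<open>5\<close> have sign \<open>1\<close> and leave no room for a subgroup of index \<open>2\<close>; comparing orders, it is the alternating
  group.
\<close>

\<comment> \<open>Frees \<open>prime\<close> for numbers and \<open><#\<close> for cosets.\<close>
hide_const (open) Divisibility.prime
no_notation subset_mset (infix \<open><#\<close> 50)

section \<open>Prime factors of the product of all element orders\<close>

subsection \<open>Additivity of \<open>bigOmega\<close>\<close>

lemma bigOmega_eq_size: "bigOmega m = size (prime_factorization m)"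
  by (auto simp: bigOmega_def size_multiset_overloaded_eq count_prime_factorization_prime
    in_prime_factors_imp_prime intro!: sum.cong)

lemma bigOmega_prod:
  assumes "finite A" "\<And>x. x \<in> A \<Longrightarrow> f x \<noteq> 0"
  shows "bigOmega (prod f A) = (\<Sum>x\<in>A. bigOmega (f x))"
  using assms by (simp add: bigOmega_eq_size prime_factorization_prod)

lemma bigOmega_pos_iff: "0 < bigOmega n \<longleftrightarrow> 1 < n"
proof -
  have "0 < bigOmega n \<longleftrightarrow> \<not> (n = 0 \<or> is_unit n)"
    by (simp add: bigOmega_eq_size nonempty_has_size[symmetric] prime_factorization_empty_iff)
  then show ?thesis by auto
qed

lemma bigOmega_1 [simp]: "bigOmega (Suc 0) = 0"
  by (simp add: bigOmega_eq_size)

lemma bigOmega_eq_1_iff: "bigOmega n = 1 \<longleftrightarrow> prime n"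
proof
  assume n: "bigOmega n = 1"
  then obtain p where p: "prime_factorization n = {#p#}"
    using size_1_singleton_mset by (auto simp: bigOmega_eq_size)
  have "n > 1" using n bigOmega_pos_iff[of n] by simp
  hence "n = p" using p prod_mset_prime_factorization_nat[of n] by simp
  moreover have "prime p" using p by (metis in_prime_factors_imp_prime union_single_eq_member)
  ultimately show "prime n" by simp
qed (simp add: bigOmega_eq_size prime_factorization_prime)

subsection \<open>The value of \<open>Omega_rho\<close> detects groups whose elements have prime order\<close>

context group begin

lemma Omega_rho_eq_sum:
  assumes "finite (carrier G)"
  shows "Omega_rho G = (\<Sum>x\<in>carrier G - {\<one>}. bigOmega (ord x))"
proof -
  have "ord x \<noteq> 0" if "x \<in> carrier G" for x
    using ord_ge_1[OF assms that] by simp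
  then show ?thesis
    unfolding Omega_rho_def rho_def
    using assms by (simp add: bigOmega_prod sum.remove[of _ \<one>])
qed

lemma ord_gt_1:
  assumes "finite (carrier G)" "x \<in> carrier G" "x \<noteq> \<one>"
  shows "1 < ord x"
  using ord_ge_1[OF assms(1,2)] ord_eq_1[OF assms(2)] assms(3) by linarith

lemma bigOmega_ord_ge_1:
  assumes "finite (carrier G)" "x \<in> carrier G - {\<one>}"
  shows "1 \<le> bigOmega (ord x)"
  using ord_gt_1[of x] bigOmega_pos_iff[of "ord x"] assms by simp

lemma Omega_rho_ge:
  assumes "finite (carrier G)"
  shows "order G - 1 \<le> Omega_rho G"
proof -
  have "card (carrier G - {\<one>}) \<le> (\<Sum>x\<in>carrier G - {\<one>}. bigOmega (ord x))"
    unfolding card_eq_sum by (rule sum_mono) (rule bigOmega_ord_ge_1[OF assms])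
  then show ?thesis
    using assms by (simp add: Omega_rho_eq_sum order_def card_Diff_singleton)
qed

text \<open>
  Each of the \<open>order G - 1\<close> nontrivial elements contributes at least \<open>1\<close>, and exactly \<open>1\<close> if and
  only if its order is prime.
\<close>

lemma Omega_rho_eq_order_minus_1_iff:
  assumes "finite (carrier G)"
  shows "Omega_rho G = order G - 1 \<longleftrightarrow> (\<forall>x\<in>carrier G - {\<one>}. prime (ord x))"
proof -
  let ?A = "carrier G - {\<one>}"
  have "order G - 1 = (\<Sum>x\<in>?A. 1)"
    using assms by (simp add: order_def card_Diff_singleton)
  moreover have "(\<Sum>x\<in>?A. 1) = (\<Sum>x\<in>?A. bigOmega (ord x)) \<longleftrightarrow> (\<forall>x\<in>?A. 1 = bigOmega (ord x))"
  proof
    assume "(\<Sum>x\<in>?A. 1) = (\<Sum>x\<in>?A. bigOmega (ord x))"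
    then show "\<forall>x\<in>?A. 1 = bigOmega (ord x)"
      using sum_mono_inv[of "\<lambda>_. 1" ?A "\<lambda>x. bigOmega (ord x)"]
        bigOmega_ord_ge_1[OF assms] assms by blast
  qed (rule sum.cong, simp_all)
  ultimately show ?thesis
    unfolding Omega_rho_eq_sum[OF assms] bigOmega_eq_1_iff[symmetric] by metis
qed

text \<open>
  Cauchy's theorem is applied to centralizers, hence the form relative to a subgroup. A Sylow
  subgroup to the exponent \<open>1\<close> has order \<open>p\<close>, so its nontrivial elements have order \<open>p\<close>.
\<close>

lemma cauchy_subgroup:
  assumes H: "subgroup H G" "finite H" and p: "prime p" "p dvd card H"
  obtains x where "x \<in> H" "ord x = p"
proof -
  interpret H: group "G\<lparr>carrier := H\<rparr>"
    using H(1) by (rule subgroup.subgroup_is_group) (rule is_group)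
  obtain K where K: "subgroup K (G\<lparr>carrier := H\<rparr>)" "card K = p"
    using sylow_thm[OF p(1) H.is_group, of 1 "card H div p"] H(2) p(2) by (auto simp: order_def)
  have KG: "subgroup K G" using incl_subgroup[OF H(1) K(1)] .
  interpret K: group "G\<lparr>carrier := K\<rparr>"
    using KG by (rule subgroup.subgroup_is_group) (rule is_group)
  have "1 < card K" using K(2) p(1) prime_gt_1_nat by simp
  then have "\<not> K \<subseteq> {\<one>}" using card_mono[of "{\<one>}" K] by auto
  then obtain x where x: "x \<in> K" "x \<noteq> \<one>" by blast
  have xG: "x \<in> carrier G" using x(1) KG subgroup.mem_carrier by fastforce
  have "x [^] p = \<one>"
    using K.pow_order_eq_1[of x] x(1) K(2) by (simp add: order_def nat_pow_consistent[symmetric])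
  hence "ord x dvd p" using xG pow_eq_id by blast
  hence "ord x = p" using p(1) ord_eq_1[OF xG] x(2) by (auto simp: prime_nat_iff)
  moreover have "x \<in> H" using x(1) K(1) subgroup.subset by fastforce
  ultimately show thesis using that by blast
qed

end

section \<open>Groups in which every nontrivial element has prime order\<close>

locale prime_order_elements_group = group +
  assumes finite_carrier: "finite (carrier G)"
    and prime_ord: "x \<in> carrier G \<Longrightarrow> x \<noteq> \<one> \<Longrightarrow> prime (ord x)"
begin

abbreviation conj_act where "conj_act \<equiv> \<lambda>g. \<lambda>h\<in>carrier G. g \<otimes> h \<otimes> inv g"

abbreviation conj_class where "conj_class \<equiv> orbit G conj_act"

abbreviation centralizer where "centralizer \<equiv> stabilizer G conj_act"

sublocale conj: group_action G "carrier G" conj_act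
  by (rule action_by_conjugation)

lemma conj_class_eq: "x \<in> carrier G \<Longrightarrow> conj_class x = (\<lambda>g. g \<otimes> x \<otimes> inv g) ` carrier G"
  by (auto simp: orbit_def)

lemma centralizer_eq:
  assumes "x \<in> carrier G"
  shows "centralizer x = {y \<in> carrier G. y \<otimes> x = x \<otimes> y}"
  using assms unfolding stabilizer_def by (auto simp: inv_solve_right')

lemma ord_conj:
  assumes "g \<in> carrier G" "x \<in> carrier G"
  shows "ord (g \<otimes> x \<otimes> inv g) = ord x"
proof -
  have pow: "(g \<otimes> x \<otimes> inv g) [^] n = g \<otimes> x [^] n \<otimes> inv g" for n :: nat
  proof (induction n)
    case (Suc n)
    have "(g \<otimes> x \<otimes> inv g) [^] Suc n = (g \<otimes> x [^] n \<otimes> inv g) \<otimes> (g \<otimes> x \<otimes> inv g)"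
      using Suc by simp
    also have "\<dots> = g \<otimes> x [^] n \<otimes> (inv g \<otimes> g) \<otimes> x \<otimes> inv g"
      using assms by (simp only: m_assoc inv_closed m_closed nat_pow_closed)
    also have "\<dots> = g \<otimes> x [^] Suc n \<otimes> inv g"
      using assms by (simp add: m_assoc)
    finally show ?case .
  qed (use assms in simp)
  have "(g \<otimes> x \<otimes> inv g) [^] n = \<one> \<longleftrightarrow> x [^] n = \<one>" for n :: nat
    unfolding pow using assms by (metis inv_solve_right' l_cancel_one' l_one m_closed nat_pow_closed
        one_closed r_inv r_one)
  then show ?thesis
    using assms by (intro ord_unique[THEN iffD2, symmetric]) (auto simp: pow_eq_id)
qed

text \<open>
  Commuting elements of two different prime orders \<open>p\<close> and \<open>q\<close> would have a product of order \<open>p * q\<close>,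
  which is not prime.
\<close>

lemma ord_eq_if_commute:
  assumes x: "x \<in> carrier G" "x \<noteq> \<one>" and y: "y \<in> carrier G" "y \<noteq> \<one>" and xy: "x \<otimes> y = y \<otimes> x"
  shows "ord y = ord x"
proof (cases "x \<otimes> y = \<one>")
  case True
  then show ?thesis using x y inv_equality ord_inv by (metis xy)
next
  case False
  let ?p = "ord x" and ?q = "ord y" and ?z = "x \<otimes> y"
  have z: "?z \<in> carrier G" using x y by simp
  have pow: "?z [^] n = x [^] n \<otimes> y [^] n" for n :: nat
    using pow_mult_distrib[OF xy] x y by simp
  have "prime (ord ?z)" using prime_ord[OF z False] .
  moreover have "ord ?z dvd ?p * ?q"
    using ord_mul_divides[OF xy] x y by simp
  ultimately have "ord ?z dvd ?p \<or> ord ?z dvd ?q" by (simp add: prime_dvd_mult_nat)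
  then show ?thesis
  proof
    assume "ord ?z dvd ?p"
    then have "?z [^] ?p = \<one>" using pow_eq_id[OF z] by simp
    then have "y [^] ?p = \<one>" using pow[of ?p] x y by simp
    then have "?q dvd ?p" using pow_eq_id[OF y(1)] by simp
    then show ?thesis using prime_ord x y primes_dvd_imp_eq by blast
  next
    assume "ord ?z dvd ?q"
    then have "?z [^] ?q = \<one>" using pow_eq_id[OF z] by simp
    then have "x [^] ?q = \<one>" using pow[of ?q] x y by simp
    then have "?p dvd ?q" using pow_eq_id[OF x(1)] by simp
    then show ?thesis using prime_ord x y primes_dvd_imp_eq by metis
  qed
qed

lemma class_equation:
  assumes "x \<in> carrier G"
  shows "card (conj_class x) * card (centralizer x) = order G"
  using conj.orbit_stabilizer_theorem[OF assms] .

text \<open>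
  By Cauchy's theorem and \<open>ord_eq_if_commute\<close>, the centralizer of an element of order \<open>p\<close> is a
  \<open>p\<close>-group. Hence its index absorbs the whole part \<open>m\<close> of the group order that is prime to \<open>p\<close>.
\<close>

lemma conj_class_dvd:
  assumes x: "x \<in> carrier G" "prime (ord x)" and m: "order G = ord x ^ a * m" "\<not> ord x dvd m"
  shows "m dvd card (conj_class x)"
proof -
  have C: "subgroup (centralizer x) G" using conj.stabilizer_subgroup[OF x(1)] .
  have x1: "x \<noteq> \<one>" using x(2) ord_eq_1[OF x(1)] by force
  have "coprime m (card (centralizer x))"
  proof (rule ccontr)
    assume "\<not> coprime m (card (centralizer x))"
    then have "gcd m (card (centralizer x)) \<noteq> 1" by (simp add: coprime_iff_gcd_eq_1)
    from prime_factor_nat[OF this]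
    obtain q where q: "prime q" "q dvd m" "q dvd card (centralizer x)" by auto
    then obtain y where y: "y \<in> centralizer x" "ord y = q"
      using cauchy_subgroup[OF C _ q(1,3)] C finite_carrier finite_subset subgroup.subset by blast
    have "y \<noteq> \<one>" using y(2) q(1) by auto
    then have "q = ord x"
      using ord_eq_if_commute[OF x(1) x1, of y] y centralizer_eq[OF x(1)] by auto
    then show False using q(2) m(2) by simp
  qed
  moreover have "m dvd card (conj_class x) * card (centralizer x)"
    using class_equation[OF x(1)] m(1) by simp
  ultimately show ?thesis by (simp add: coprime_dvd_mult_left_iff)
qed

lemma conj_class_disjoint:
  assumes "x \<in> carrier G" "y \<in> carrier G" "conj_class x \<noteq> conj_class y"
  shows "conj_class x \<inter> conj_class y = {}"
  using conj.disjoint_union assms unfolding orbits_def by blast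

lemma conj_class_subset_same_ord: "x \<in> carrier G \<Longrightarrow> conj_class x \<subseteq> {y \<in> carrier G. ord y = ord x}"
  by (auto simp: conj_class_eq ord_conj)

lemma card_same_ord_dvd:
  assumes p: "prime p" and m: "order G = p ^ a * m" "\<not> p dvd m"
  shows "m dvd card {x \<in> carrier G. ord x = p}"
proof -
  let ?X = "{x \<in> carrier G. ord x = p}"
  have "?X = \<Union>(conj_class ` ?X)"
  proof
    show "?X \<subseteq> \<Union>(conj_class ` ?X)" using conj.orbit_refl by (auto simp del: restrict_apply)
    show "\<Union>(conj_class ` ?X) \<subseteq> ?X" using conj_class_subset_same_ord by fastforce
  qed
  moreover have "m dvd card (\<Union>(conj_class ` ?X))"
  proof (rule dvd_partition)
    show "finite (\<Union>(conj_class ` ?X))" using calculation finite_carrier by simp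
    show "\<forall>c\<in>conj_class ` ?X. m dvd card c" using conj_class_dvd p m by blast
    show "\<forall>c\<in>conj_class ` ?X. \<forall>d\<in>conj_class ` ?X. c \<noteq> d \<longrightarrow> c \<inter> d = {}"
      using conj_class_disjoint by blast
  qed
  ultimately show ?thesis by simp
qed

end

text \<open>
  Numbering the points of an orbit turns the action on it into a homomorphism to a symmetric
  group; an element of its kernel fixes every point of the orbit, in particular \<open>x\<close>.
\<close>

lemma (in group_action) orbit_permutation_representation:
  assumes x: "x \<in> E" and fin: "finite (orbit G \<phi> x)"
  obtains h where "h \<in> hom G (sym_group (card (orbit G \<phi> x)))"
    and "kernel G (sym_group (card (orbit G \<phi> x))) h \<subseteq> stabilizer G \<phi> x"
proof -
  interpret G: group G using group_hom group_hom.axioms(1) by blast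
  define Orb where "Orb = orbit G \<phi> x"
  define n where "n = card Orb"
  obtain e where e: "bij_betw e {1..n} Orb"
    using ex_bij_betw_nat_finite_1 fin unfolding Orb_def n_def by blast
  have OE: "Orb \<subseteq> E" using x element_image unfolding Orb_def orbit_def by blast
  have act: "\<phi> g y \<in> Orb" if g: "g \<in> carrier G" and y: "y \<in> Orb" for g y
  proof -
    obtain f where f: "f \<in> carrier G" "y = \<phi> f x" using y unfolding Orb_def orbit_def by blast
    then have "\<phi> g y = \<phi> (g \<otimes> f) x" using composition_rule[OF x g f(1)] by simp
    then show ?thesis using g f(1) unfolding Orb_def orbit_def by blast
  qed
  define h where "h g = (\<lambda>i. if i \<in> {1..n} then inv_into {1..n} e (\<phi> g (e i)) else i)" for g
  have e_mem: "e i \<in> Orb" if "i \<in> {1..n}" for i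
    using e that by (auto simp: bij_betw_def)
  have h_mem: "h g i \<in> {1..n}" and e_h: "e (h g i) = \<phi> g (e i)"
    if "g \<in> carrier G" "i \<in> {1..n}" for g i
  proof -
    have "\<phi> g (e i) \<in> e ` {1..n}"
      using act[OF that(1) e_mem[OF that(2)]] e by (simp add: bij_betw_def)
    then show "h g i \<in> {1..n}" "e (h g i) = \<phi> g (e i)"
      using that(2) unfolding h_def by (auto simp only: inv_into_into f_inv_into_f if_True)
  qed
  have e_eq: "i = j" if "e i = e j" "i \<in> {1..n}" "j \<in> {1..n}" for i j
    using e that by (meson bij_betw_def inj_onD)
  have perm: "h g permutes {1..n}" if g: "g \<in> carrier G" for g
  proof (rule bij_imp_permutes)
    have "inj_on (h g) {1..n}"
    proof (rule inj_onI)
      fix i j assume ij: "i \<in> {1..n}" "j \<in> {1..n}" "h g i = h g j"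
      then have "\<phi> g (e i) = \<phi> g (e j)" using e_h[OF g] by metis
      then have "e i = e j"
        using inj_prop[OF g] e_mem ij OE by (meson inj_onD subsetD)
      then show "i = j" using e_eq ij by blast
    qed
    then show "bij_betw (h g) {1..n} {1..n}"
      using h_mem[OF g] unfolding bij_betw_def by (intro conjI endo_inj_surj) blast+
  qed (simp only: h_def if_False)
  have "h (f \<otimes> g) = h f \<circ> h g" if "f \<in> carrier G" "g \<in> carrier G" for f g
  proof
    fix i
    show "h (f \<otimes> g) i = (h f \<circ> h g) i"
    proof (cases "i \<in> {1..n}")
      case True
      have "e (h (f \<otimes> g) i) = \<phi> (f \<otimes> g) (e i)"
        using True that by (intro e_h G.m_closed)
      also have "\<dots> = \<phi> f (\<phi> g (e i))"
        using composition_rule that e_mem[OF True] OE by blast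
      also have "\<dots> = e ((h f \<circ> h g) i)"
        unfolding o_apply e_h[OF that(1) h_mem[OF that(2) True]] e_h[OF that(2) True] ..
      finally show ?thesis
        by (rule e_eq[OF _ h_mem[OF G.m_closed[OF that] True]])
          (unfold o_apply, rule h_mem[OF that(1) h_mem[OF that(2) True]])
    qed (simp only: h_def if_False o_apply)
  qed
  then have "h \<in> hom G (sym_group n)"
    using perm by (auto simp: hom_def sym_group_carrier sym_group_mult)
  moreover have "kernel G (sym_group n) h \<subseteq> stabilizer G \<phi> x"
  proof
    fix g assume "g \<in> kernel G (sym_group n) h"
    then have g: "g \<in> carrier G" "h g = id" by (auto simp: kernel_def sym_group_one)
    have "x \<in> e ` {1..n}"
      using orbit_refl[OF x] by (simp only: bij_betw_imp_surj_on[OF e] Orb_def)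
    then obtain i where i: "i \<in> {1..n}" "e i = x" by blast
    then show "g \<in> stabilizer G \<phi> x"
      using e_h[OF g(1) i(1)] g by (simp add: stabilizer_def)
  qed
  ultimately show thesis using that unfolding Orb_def n_def by blast
qed

section \<open>Order 60: identification with the alternating group\<close>

locale prime_order_elements_group_60 = prime_order_elements_group +
  assumes order_60: "order G = 60"
begin

definition elems_of_ord where "elems_of_ord p = {x \<in> carrier G. ord x = p}"

lemma finite_elems_of_ord [simp]: "finite (elems_of_ord p)"
  using finite_carrier by (simp add: elems_of_ord_def)

lemma elems_of_ord_disjoint: "p \<noteq> q \<Longrightarrow> elems_of_ord p \<inter> elems_of_ord q = {}"
  by (auto simp: elems_of_ord_def)

lemma ord_cases:
  assumes "x \<in> carrier G" "x \<noteq> \<one>"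
  shows "ord x = 2 \<or> ord x = 3 \<or> ord x = 5"
proof -
  have p: "prime (ord x)" using prime_ord assms by blast
  have "ord x dvd 2 * 2 * 3 * 5"
    using ord_dvd_group_order[OF assms(1)] order_60 by simp
  then have "ord x dvd 2 \<or> ord x dvd 3 \<or> ord x dvd 5"
    using p by (simp only: prime_dvd_mult_iff) blast
  moreover have "prime (2::nat)" "prime (3::nat)" "prime (5::nat)" by simp_all
  ultimately show ?thesis using p primes_dvd_imp_eq by blast
qed

text \<open>
  The three numbers are positive multiples of \<open>15\<close>, \<open>20\<close> and \<open>12\<close> with sum \<open>59\<close>, and
  \<open>15 * a + 20 * b + 12 * c = 59\<close> has only one solution in positive integers.
\<close>

lemma card_elems_of_ord:
  shows "card (elems_of_ord 2) = 15" "card (elems_of_ord 3) = 20" "card (elems_of_ord 5) = 24"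
proof -
  have pos: "0 < card (elems_of_ord p)" if p: "prime p" "p dvd 60" for p
  proof -
    obtain x where "x \<in> carrier G" "ord x = p"
      using cauchy_subgroup[OF subgroup_self finite_carrier p(1)] p(2) order_60
      by (auto simp: order_def)
    then show ?thesis using finite_elems_of_ord[of p] by (auto simp: card_gt_0_iff elems_of_ord_def)
  qed
  have "15 dvd card (elems_of_ord 2)" "20 dvd card (elems_of_ord 3)" "12 dvd card (elems_of_ord 5)"
    using card_same_ord_dvd[of 2 2 15] card_same_ord_dvd[of 3 1 20] card_same_ord_dvd[of 5 1 12]
    by (simp_all add: order_60 elems_of_ord_def)
  then obtain a b c where abc: "card (elems_of_ord 2) = 15 * a" "card (elems_of_ord 3) = 20 * b"
    "card (elems_of_ord 5) = 12 * c" by (elim dvdE)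
  have "carrier G - {\<one>} = elems_of_ord 2 \<union> elems_of_ord 3 \<union> elems_of_ord 5"
    using ord_cases by (auto simp: elems_of_ord_def)
  then have "card (elems_of_ord 2 \<union> elems_of_ord 3 \<union> elems_of_ord 5) = 59"
    using order_60 finite_carrier card_Diff_singleton[OF one_closed] by (simp add: order_def)
  moreover have "card (elems_of_ord 2 \<union> elems_of_ord 3 \<union> elems_of_ord 5) =
      card (elems_of_ord 2) + card (elems_of_ord 3) + card (elems_of_ord 5)"
    by (simp add: card_Un_disjoint Int_Un_distrib2 elems_of_ord_disjoint)
  ultimately have eq: "15 * a + 20 * b + 12 * c = 59" using abc by simp
  have "0 < a" "0 < b" "0 < c"
    using pos[of 2] pos[of 3] pos[of 5] abc by simp_all
  then have "a = 1 \<and> b = 1 \<and> c = 2" using eq by presburger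
  then show "card (elems_of_ord 2) = 15" "card (elems_of_ord 3) = 20" "card (elems_of_ord 5) = 24"
    using abc by simp_all
qed

lemma card_conj_class_pos:
  assumes "x \<in> carrier G"
  shows "0 < card (conj_class x)"
  using class_equation[OF assms] order_60 by (intro Nat.gr0I) simp

lemma card_conj_class_ge:
  assumes x: "x \<in> carrier G" "x \<noteq> \<one>"
  shows "12 \<le> card (conj_class x)"
proof -
  have "15 dvd card (conj_class x) \<or> 20 dvd card (conj_class x) \<or> 12 dvd card (conj_class x)"
    using ord_cases[OF x] conj_class_dvd[OF x(1) prime_ord[OF x], of 2 15]
      conj_class_dvd[OF x(1) prime_ord[OF x], of 1 20]
      conj_class_dvd[OF x(1) prime_ord[OF x], of 1 12] by (auto simp: order_60)
  then show ?thesis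
    using card_conj_class_pos[OF x(1)] by (auto dest!: dvd_imp_le)
qed

text \<open>
  The size of the class of an involution is a multiple of \<open>15\<close>, and there are only \<open>15\<close> involutions.
\<close>

lemma conj_class_involution:
  assumes "t \<in> elems_of_ord 2"
  shows "conj_class t = elems_of_ord 2"
proof -
  have t: "t \<in> carrier G" "ord t = 2" using assms by (auto simp: elems_of_ord_def)
  have sub: "conj_class t \<subseteq> elems_of_ord 2"
    using conj_class_subset_same_ord[OF t(1)] t(2) by (simp add: elems_of_ord_def)
  have "15 \<le> card (conj_class t)"
    using conj_class_dvd[OF t(1), of 2 15] t(2) card_conj_class_pos[OF t(1)]
    by (intro dvd_imp_le) (auto simp: order_60)
  then show ?thesis
    using card_seteq[OF _ sub] finite_carrier card_elems_of_ord(1) by (simp add: elems_of_ord_def)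
qed

text \<open>
  These are the nontrivial elements of the Sylow \<open>2\<close>-subgroup that contains the involution \<open>t\<close>. The five
  sets of this form are the points on which the group acts.
\<close>

definition commuting_involutions where
  "commuting_involutions t = {u \<in> elems_of_ord 2. u \<otimes> t = t \<otimes> u}"

lemma centralizer_involution:
  assumes "t \<in> elems_of_ord 2"
  shows "centralizer t = insert \<one> (commuting_involutions t)"
proof -
  have t: "t \<in> carrier G" "ord t = 2" "t \<noteq> \<one>"
    using assms by (auto simp: elems_of_ord_def)
  show ?thesis
    using ord_eq_if_commute[OF t(1,3)] t(1,2)
    by (auto simp: centralizer_eq commuting_involutions_def elems_of_ord_def)
qed

lemma card_commuting_involutions:
  assumes t: "t \<in> elems_of_ord 2"
  shows "card (commuting_involutions t) = 3"
proof -
  have "15 * card (centralizer t) = 60"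
    using class_equation[of t] t order_60
    by (simp add: conj_class_involution card_elems_of_ord) (simp add: elems_of_ord_def)
  moreover have "\<one> \<notin> commuting_involutions t" "finite (commuting_involutions t)"
    using finite_carrier by (auto simp: commuting_involutions_def elems_of_ord_def)
  ultimately show ?thesis
    by (simp add: centralizer_involution[OF t])
qed

text \<open>
  The centralizer of \<open>t\<close> consists of elements of square \<open>\<one>\<close>, so it is abelian. It is therefore
  contained in the centralizer of each of its involutions, and all these centralizers have the same size.
\<close>

lemma commuting_involutions_eq:
  assumes t: "t \<in> elems_of_ord 2" and u: "u \<in> commuting_involutions t"
  shows "commuting_involutions u = commuting_involutions t"
proof (rule sym, rule card_seteq)
  have uI: "u \<in> elems_of_ord 2" using u by (simp add: commuting_involutions_def)
  have tG: "t \<in> carrier G" using t by (simp add: elems_of_ord_def)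
  have self_inv: "inv y = y" if "y \<in> centralizer t" for y
  proof -
    have "y \<in> carrier G" using that by (simp add: stabilizer_def)
    moreover have "y [^] (2::nat) = \<one>"
    proof (cases "y = \<one>")
      case False
      then have "ord y = 2"
        using that unfolding centralizer_involution[OF t]
        by (simp add: commuting_involutions_def elems_of_ord_def)
      then show ?thesis using pow_ord_eq_1[OF calculation] by simp
    qed simp
    ultimately show ?thesis by (intro inv_equality) (simp_all add: numeral_2_eq_2)
  qed
  show "commuting_involutions t \<subseteq> commuting_involutions u"
  proof
    fix v assume v: "v \<in> commuting_involutions t"
    have C: "u \<in> centralizer t" "v \<in> centralizer t"
      using u v by (simp_all add: centralizer_involution[OF t])
    then have G: "u \<in> carrier G" "v \<in> carrier G" by (simp_all add: stabilizer_def)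
    have "u \<otimes> v \<in> centralizer t"
      using C subgroup.m_closed[OF conj.stabilizer_subgroup[OF tG]] by blast
    then have "u \<otimes> v = inv (u \<otimes> v)" by (rule self_inv[symmetric])
    also have "\<dots> = inv v \<otimes> inv u" by (rule inv_mult_group[OF G])
    also have "\<dots> = v \<otimes> u" by (simp only: self_inv[OF C(1)] self_inv[OF C(2)])
    finally have "v \<otimes> u = u \<otimes> v" ..
    then show "v \<in> commuting_involutions u"
      using v by (simp add: commuting_involutions_def)
  qed
  show "finite (commuting_involutions u)"
    using finite_carrier by (simp add: commuting_involutions_def elems_of_ord_def)
  show "card (commuting_involutions u) \<le> card (commuting_involutions t)"
    using t uI by (simp add: card_commuting_involutions)
qed

lemma conj_commuting_involutions:
  assumes t: "t \<in> elems_of_ord 2" and g: "g \<in> carrier G"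
  shows "g <# commuting_involutions t #> inv g = commuting_involutions (g \<otimes> t \<otimes> inv g)"
proof (rule card_seteq)
  let ?c = "\<lambda>h. g \<otimes> h \<otimes> inv g"
  have tG: "t \<in> carrier G" using t by (simp add: elems_of_ord_def)
  have I: "?c u \<in> elems_of_ord 2" if "u \<in> elems_of_ord 2" for u
    using that g by (auto simp: elems_of_ord_def ord_conj)
  have BG: "commuting_involutions t \<subseteq> carrier G"
    by (auto simp: commuting_involutions_def elems_of_ord_def)
  have img: "g <# commuting_involutions t #> inv g = ?c ` commuting_involutions t"
    by (auto simp: l_coset_def r_coset_def)
  have mult: "?c u \<otimes> ?c v = ?c (u \<otimes> v)" if "u \<in> carrier G" "v \<in> carrier G" for u v
  proof -
    have "?c u \<otimes> ?c v = g \<otimes> u \<otimes> (inv g \<otimes> g) \<otimes> v \<otimes> inv g"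
      using that g by (simp only: m_assoc inv_closed m_closed)
    then show ?thesis using that g by (simp add: m_assoc)
  qed
  show "g <# commuting_involutions t #> inv g \<subseteq> commuting_involutions (?c t)"
    unfolding img
  proof (rule image_subsetI)
    fix u assume u: "u \<in> commuting_involutions t"
    then have "u \<in> carrier G" using BG by blast
    then show "?c u \<in> commuting_involutions (?c t)"
      using u I tG by (auto simp: commuting_involutions_def mult)
  qed
  show "finite (commuting_involutions (?c t))"
    using finite_carrier by (simp add: commuting_involutions_def elems_of_ord_def)
  have "inj_on ?c (commuting_involutions t)"
    using g BG by (auto intro!: inj_onI simp: subset_iff)
  then show "card (commuting_involutions (?c t)) \<le> card (g <# commuting_involutions t #> inv g)"
    using t I by (simp add: img card_image card_commuting_involutions)
qed

text \<open>
  Blocks with a common element coincide, so the \<open>15\<close> involutions are partitioned into blocks of \<open>3\<close>.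
\<close>

lemma card_commuting_blocks: "card (commuting_involutions ` elems_of_ord 2) = 5"
proof -
  let ?B = "commuting_involutions ` elems_of_ord 2"
  have refl: "t \<in> commuting_involutions t" if "t \<in> elems_of_ord 2" for t
    using that by (simp add: commuting_involutions_def)
  have Un: "\<Union>?B = elems_of_ord 2"
    using refl by (auto simp: commuting_involutions_def)
  have "3 * card ?B = card (\<Union>?B)"
  proof (rule card_partition)
    fix c d assume "c \<in> ?B" "d \<in> ?B" "c \<noteq> d"
    then show "c \<inter> d = {}" using commuting_involutions_eq by blast
  qed (use Un card_commuting_involutions in auto)
  then show ?thesis by (simp add: Un card_elems_of_ord)
qed

abbreviation conj_set_act where
  "conj_set_act \<equiv> \<lambda>g. \<lambda>H\<in>{H. H \<subseteq> carrier G}. g <# H #> inv g"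

sublocale conj_set: group_action G "{H. H \<subseteq> carrier G}" conj_set_act
  by (rule action_by_conjugation_on_power_set)

lemma orbit_commuting_involutions:
  assumes t: "t \<in> elems_of_ord 2"
  shows "orbit G conj_set_act (commuting_involutions t) = commuting_involutions ` elems_of_ord 2"
proof -
  have tG: "t \<in> carrier G" using t by (simp add: elems_of_ord_def)
  have BG: "commuting_involutions t \<subseteq> carrier G"
    by (auto simp: commuting_involutions_def elems_of_ord_def)
  have "orbit G conj_set_act (commuting_involutions t)
      = (\<lambda>g. conj_set_act g (commuting_involutions t)) ` carrier G"
    unfolding orbit_def by blast
  also have "\<dots> = (\<lambda>g. commuting_involutions (g \<otimes> t \<otimes> inv g)) ` carrier G"
    using BG conj_commuting_involutions[OF t] by (intro image_cong) simp_all
  also have "\<dots> = commuting_involutions ` conj_class t"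
    unfolding conj_class_eq[OF tG] image_image ..
  finally have "orbit G conj_set_act (commuting_involutions t) = commuting_involutions ` conj_class t" .
  then show ?thesis by (simp add: conj_class_involution[OF t])
qed

text \<open>
  The kernel of the action on the five blocks lies in the stabilizer of a block, which has order
  \<open>60 / 5 = 12\<close>. A nontrivial element of the kernel would bring its whole class, of size at least \<open>12\<close>,
  and together with \<open>\<one>\<close> this is already too much.
\<close>

lemma embeds_in_S5:
  obtains h where "h \<in> hom G (sym_group 5)" "inj_on h (carrier G)"
proof -
  have "elems_of_ord 2 \<noteq> {}" using card_elems_of_ord(1) by force
  then obtain t where t: "t \<in> elems_of_ord 2" by blast
  let ?B = "commuting_involutions t"
  have B: "?B \<in> {H. H \<subseteq> carrier G}"
    by (auto simp: commuting_involutions_def elems_of_ord_def)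
  have c5: "card (orbit G conj_set_act ?B) = 5"
    using orbit_commuting_involutions[OF t] card_commuting_blocks by simp
  have fin: "finite (orbit G conj_set_act ?B)"
    using c5 card.infinite by fastforce
  obtain h where h: "h \<in> hom G (sym_group 5)"
    and ker: "kernel G (sym_group 5) h \<subseteq> stabilizer G conj_set_act ?B"
    by (rule conj_set.orbit_permutation_representation[OF B fin, unfolded c5])
  interpret h: group_hom G "sym_group 5" h
    using h by (intro group_hom.intro is_group sym_group_is_group group_hom_axioms.intro)
  let ?K = "kernel G (sym_group 5) h"
  have "card (stabilizer G conj_set_act ?B) = 12"
    using conj_set.orbit_stabilizer_theorem[OF B] c5 order_60 by simp
  then have K12: "card ?K \<le> 12"
    using card_mono[OF _ ker] by (simp add: card_ge_0_finite)
  have "x = \<one>" if x: "x \<in> ?K" for x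
  proof (rule ccontr)
    assume x1: "x \<noteq> \<one>"
    have xG: "x \<in> carrier G" using x by (simp add: kernel_def)
    have "conj_class x \<subseteq> ?K"
      using x normal.inv_op_closed2[OF h.normal_kernel] by (auto simp: conj_class_eq[OF xG])
    moreover have "\<one> \<notin> conj_class x"
      using conj_class_subset_same_ord[OF xG] x1 ord_eq_1[OF xG] by auto
    moreover have "\<one> \<in> ?K" by (rule subgroup.one_closed[OF h.subgroup_kernel])
    ultimately have "conj_class x \<subset> ?K" by blast
    then have "card (conj_class x) < card ?K"
      using finite_carrier by (intro psubset_card_mono) (simp_all add: kernel_def)
    then show False using card_conj_class_ge[OF xG x1] K12 by simp
  qed
  then have "?K = {\<one>}" using subgroup.one_closed[OF h.subgroup_kernel] by blast
  then have "inj_on h (carrier G)" by (rule h.trivial_ker_imp_inj)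
  then show thesis using that h by blast
qed

text \<open>
  The elements of odd order lie in the kernel. There are at least \<open>44\<close> of them, more than half of the
  group, so the kernel is the whole group.
\<close>

lemma hom_sign_img_trivial:
  assumes s: "s \<in> hom G sign_img" and x: "x \<in> carrier G"
  shows "s x = 1"
proof -
  interpret s: group_hom G sign_img s
    using s by (intro group_hom.intro is_group sign_img_is_group group_hom_axioms.intro)
  let ?L = "kernel G sign_img s"
  have pow: "y [^]\<^bsub>sign_img\<^esub> n = y ^ n" for y and n :: nat
    by (induction n) (simp_all add: sign_img_def nat_pow_def)
  have odd: "y \<in> ?L" if y: "y \<in> carrier G" "odd (ord y)" for y
  proof -
    have "s y ^ ord y = 1"
      using s.hom_nat_pow[OF y(1), of "ord y"] y(1) by (simp add: pow) (simp add: sign_img_def)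
    moreover have "s y = 1 \<or> s y = -1" using s.hom_closed[OF y(1)] by (auto simp: sign_img_def)
    ultimately have "s y = 1" using y(2) by auto
    then show ?thesis using y by (simp add: kernel_def sign_img_def)
  qed
  have "card (elems_of_ord 3 \<union> elems_of_ord 5) = card (elems_of_ord 3) + card (elems_of_ord 5)"
    by (simp add: card_Un_disjoint elems_of_ord_disjoint)
  moreover have "elems_of_ord 3 \<union> elems_of_ord 5 \<subseteq> ?L" using odd by (auto simp: elems_of_ord_def)
  moreover have finL: "finite ?L" using finite_carrier by (simp add: kernel_def)
  ultimately have "44 \<le> card ?L"
    using card_mono[of ?L "elems_of_ord 3 \<union> elems_of_ord 5"] by (simp add: card_elems_of_ord)
  moreover have "card (rcosets ?L) * card ?L = 60"
    using lagrange[OF s.subgroup_kernel] order_60 by simp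
  then obtain k where k: "k * card ?L = 60" by blast
  moreover have "2 * card ?L \<le> k * card ?L" if "k \<noteq> 0" "k \<noteq> 1"
    using that by (intro mult_le_mono1) simp
  moreover have "k \<noteq> 0" using k by (intro notI) simp
  ultimately have "card ?L = card (carrier G)"
    using order_60 unfolding order_def by (cases "k = 1") auto
  then have "?L = carrier G"
    using finite_carrier by (intro card_subset_eq) (auto simp: kernel_def)
  then show ?thesis using x by (auto simp: kernel_def sign_img_def)
qed

theorem iso_A5: "G \<cong> alt_group 5"
proof -
  obtain h where h: "h \<in> hom G (sym_group 5)" "inj_on h (carrier G)"
    using embeds_in_S5 .
  have "compose (carrier G) sign h \<in> hom G sign_img"
    using hom_compose[OF h(1) sign_is_hom] .
  then have "sign (h x) = (1::int)" if "x \<in> carrier G" for x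
    using hom_sign_img_trivial[OF _ that] by (simp add: compose_eq[OF that, symmetric])
  then have "evenperm (h x)" if "x \<in> carrier G" for x
    using that by (metis sign_def one_neq_neg_one)
  moreover have "h x permutes {1..5}" if "x \<in> carrier G" for x
    using hom_in_carrier[OF h(1) that] by (simp only: sym_group_carrier)
  ultimately have sub: "h ` carrier G \<subseteq> carrier (alt_group 5)"
    by (auto simp only: alt_group_carrier)
  have "2 * card (carrier (alt_group 5)) = fact 5" by (rule alt_group_card_carrier) simp
  then have A: "card (carrier (alt_group 5)) = 60" by (simp add: fact_numeral)
  then have "h ` carrier G = carrier (alt_group 5)"
    using sub order_60 card_image[OF h(2)]
    by (intro card_subset_eq) (auto simp: order_def card_ge_0_finite)
  moreover have "h \<in> hom G (alt_group 5)"
    using h(1) sub by (auto simp: hom_def alt_group_mult sym_group_mult image_subset_iff)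
  ultimately show ?thesis using h(2) by (auto simp: is_iso_def iso_def bij_betw_def)
qed

end

section \<open>Orders of even permutations of five points\<close>

lemma permutes_insertE:
  assumes "q permutes insert a S"
  obtains b r where "b \<in> insert a S" "r permutes S" "q = transpose a b \<circ> r"
proof
  show "transpose a (q a) \<circ> q permutes S" by (rule permutes_insert_lemma[OF assms])
  show "q = transpose a (q a) \<circ> (transpose a (q a) \<circ> q)" by (simp add: fun_eq_iff)
  show "q a \<in> insert a S" using permutes_in_image[OF assms, of a] by simp
qed

text \<open>
  Splitting off the value at the largest remaining point, one point at a time, gives a normal form that
  enumerates the \<open>5!\<close> permutations and shows the parity of each.
\<close>

lemma permutes_5_transpositions:
  assumes "p permutes {1..5::nat}"
  obtains b c d e where "b \<in> {2,1}" "c \<in> {3,2,1}" "d \<in> {4,3,2,1}" "e \<in> {5,4,3,2,1}"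
    "p = transpose 5 e \<circ> (transpose 4 d \<circ> (transpose 3 c \<circ> transpose 2 b))"
proof -
  have "{1..5} = {5, 4, 3, 2, 1::nat}" by auto
  with assms have "p permutes {5, 4, 3, 2, 1}" by simp
  then obtain e q where 5: "e \<in> {5, 4, 3, 2, 1}" "q permutes {4, 3, 2, 1}" "p = transpose 5 e \<circ> q"
    by (rule permutes_insertE)
  obtain d r where 4: "d \<in> {4, 3, 2, 1}" "r permutes {3, 2, 1}" "q = transpose 4 d \<circ> r"
    using 5(2) by (rule permutes_insertE)
  obtain c s where 3: "c \<in> {3, 2, 1}" "s permutes {2, 1}" "r = transpose 3 c \<circ> s"
    using 4(2) by (rule permutes_insertE)
  obtain b t where 2: "b \<in> {2, 1}" "t permutes {1}" "s = transpose 2 b \<circ> t"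
    using 3(2) by (rule permutes_insertE)
  have "t = id" using 2(2) by simp
  then show thesis using that[OF 2(1) 3(1) 4(1) 5(1)] 2(3) 3(3) 4(3) 5(3) by simp
qed

text \<open>
  An even permutation of five points is trivial, a \<open>3\<close>-cycle, a \<open>5\<close>-cycle or a product of two disjoint
  transpositions. This is verified on the \<open>60\<close> even instances of the normal form above.
\<close>

lemma even_permutes_5_pow:
  assumes "p permutes {1..5::nat}" and "evenperm p"
  shows "p ^^ 2 = id \<or> p ^^ 3 = id \<or> p ^^ 5 = id"
proof -
  obtain b c d e where bcde: "b \<in> {2,1}" "c \<in> {3,2,1}" "d \<in> {4,3,2,1}" "e \<in> {5,4,3,2,1}"
    and p: "p = transpose 5 e \<circ> (transpose 4 d \<circ> (transpose 3 c \<circ> transpose 2 b))"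
    using permutes_5_transpositions[OF assms(1)] .
  \<comment> \<open>The factor \<open>transpose a x\<close> is odd unless \<open>x = a\<close>, so an even number of the four are proper.\<close>
  have even: "((e = 5) = (d = 4)) = ((c = 3) = (b = 2))"
    using assms(2) unfolding p by (auto simp: evenperm_comp permutation_compose
      permutation_swap_id evenperm_swap)
  have id: "f = id" if f: "f permutes {1..5}" "f 1 = 1 \<and> f 2 = 2 \<and> f 3 = 3 \<and> f 4 = 4 \<and> f 5 = 5"
    for f :: "nat \<Rightarrow> nat"
  proof
    fix i :: nat
    have "i \<in> {1..5} \<Longrightarrow> i = 1 \<or> i = 2 \<or> i = 3 \<or> i = 4 \<or> i = 5" by auto
    then show "f i = id i" using f permutes_not_in[OF f(1)] by (cases "i \<in> {1..5}") auto
  qed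
  have p_at: "p i = transpose 5 e (transpose 4 d (transpose 3 c (transpose 2 b i)))" for i
    by (simp add: p)
  let ?fix = "\<lambda>f. f 1 = 1 \<and> f 2 = 2 \<and> f 3 = 3 \<and> f 4 = 4 \<and> f 5 = 5"
  have pow_at: "(p ^^ 2) i = p (p i)" "(p ^^ 3) i = p (p (p i))"
    "(p ^^ 5) i = p (p (p (p (p i))))" for i
    by (simp_all add: numeral_eq_Suc)
  \<comment> \<open>The table of values of \<open>p\<close>, evaluated first, keeps each of the cases for \<open>b, c, d, e\<close> small.\<close>
  have "?fix (p ^^ 2) \<or> ?fix (p ^^ 3) \<or> ?fix (p ^^ 5)"
    unfolding pow_at
    using bcde even p_at[of 1] p_at[of 2] p_at[of 3] p_at[of 4] p_at[of 5]
    by (elim insertE emptyE) (simp_all add: transpose_def)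
  then show ?thesis
    using id[OF permutes_funpow[OF assms(1)]] by blast
qed

lemma prime_ord_alt_group_5:
  assumes "p \<in> carrier (alt_group 5)" "p \<noteq> \<one>\<^bsub>alt_group 5\<^esub>"
  shows "prime (group.ord (alt_group 5) p)"
proof -
  interpret A: group "alt_group 5" by (rule alt_group_is_group)
  have pow: "p [^]\<^bsub>alt_group 5\<^esub> n = p ^^ n" for n :: nat
    by (induction n) (simp_all add: alt_group_one alt_group_mult funpow_swap1 fun_eq_iff)
  have "prime (A.ord p)" if "p ^^ n = id" "prime n" for n
  proof -
    have "A.ord p dvd n"
      using that(1) A.pow_eq_id[OF assms(1), of n] by (simp add: pow alt_group_one)
    then show ?thesis
      using that(2) A.ord_eq_1[OF assms(1)] assms(2) by (auto simp: prime_nat_iff)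
  qed
  then show ?thesis
    using even_permutes_5_pow[of p] assms(1) by (auto simp: alt_group_carrier)
qed

section \<open>The minimum over groups of order 60\<close>

lemma (in group_hom) ord_inj_hom:
  assumes "inj_on h (carrier G)" and x: "x \<in> carrier G"
  shows "H.ord (h x) = G.ord x"
proof -
  have "h x [^]\<^bsub>H\<^esub> n = \<one>\<^bsub>H\<^esub> \<longleftrightarrow> x [^] n = \<one>" for n :: nat
    using inj_on_eq_iff[OF assms(1) G.nat_pow_closed[OF x] G.one_closed] hom_nat_pow[OF x] by simp
  then show ?thesis
    using x by (intro H.ord_unique[THEN iffD2]) (auto simp: G.pow_eq_id)
qed

lemma Omega_rho_alt_group_5: "Omega_rho (alt_group 5) = 59"
proof -
  interpret A: group "alt_group 5" by (rule alt_group_is_group)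
  have "2 * order (alt_group 5) = fact 5"
    using alt_group_card_carrier[of 5] by (simp add: order_def)
  then have o: "order (alt_group 5) = 60" by (simp add: fact_numeral)
  then have "finite (carrier (alt_group 5))"
    using A.order_gt_0_iff_finite by simp
  then show ?thesis
    using A.Omega_rho_eq_order_minus_1_iff prime_ord_alt_group_5 o by simp
qed

theorem theorem2p14:
  fixes G :: "('a, 'b) monoid_scheme"
  assumes "group G"
    and "finite (carrier G)"
    and "order G = 60"
  shows "Omega_rho (alt_group 5) \<le> Omega_rho G \<and>
         (Omega_rho G = 59 \<longleftrightarrow> G \<cong> alt_group 5)"
proof -
  interpret group G by (rule assms(1))
  have prime_iff: "Omega_rho G = 59 \<longleftrightarrow> (\<forall>x\<in>carrier G - {\<one>\<^bsub>G\<^esub>}. prime (ord x))"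
    using Omega_rho_eq_order_minus_1_iff[OF assms(2)] assms(3) by simp
  have "Omega_rho (alt_group 5) \<le> Omega_rho G"
    using Omega_rho_ge[OF assms(2)] assms(3) by (simp add: Omega_rho_alt_group_5)
  moreover have "Omega_rho G = 59 \<longleftrightarrow> G \<cong> alt_group 5"
  proof
    assume "Omega_rho G = 59"
    then interpret prime_order_elements_group_60 G
      using assms(2,3) prime_iff by unfold_locales auto
    show "G \<cong> alt_group 5" by (rule iso_A5)
  next
    assume "G \<cong> alt_group 5"
    then obtain h where h: "h \<in> iso G (alt_group 5)" by (auto simp: is_iso_def)
    interpret h: group_hom G "alt_group 5" h
      using h by (intro group_hom.intro assms(1) alt_group_is_group group_hom_axioms.intro)
        (simp add: iso_def)
    have inj: "inj_on h (carrier G)" using h by (simp add: iso_def bij_betw_def)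
    have "prime (ord x)" if x: "x \<in> carrier G - {\<one>\<^bsub>G\<^esub>}" for x
    proof -
      have "h x \<noteq> \<one>\<^bsub>alt_group 5\<^esub>"
        using x inj_on_eq_iff[OF inj _ one_closed, of x] by simp
      then show ?thesis
        using prime_ord_alt_group_5[of "h x"] h.ord_inj_hom[OF inj, of x] x by simp
    qed
    then show "Omega_rho G = 59" using prime_iff by blast
  qed
  ultimately show ?thesis by blast
qed

end
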